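(* Let $n\geq 1$ and let $\theta$ be a reflexive and transitive binary relation on $\{1,2,\ldots,n\}$. If $R$ is a commutative ring and $A\in M_{n}(\theta,R)$ is invertible in $M_{n}(R)$, then $A^{-1}\in M_{n}(\theta,R)$.
   Context: All rings are associative with identity. $M_n(R)$ is the ring of $n\times n$ matrices over $R$. For a reflexive and transitive relation $\theta$ on $\{1,\ldots,n\}$, the structural matrix ring is the subring $M_{n}(\theta,R)=\{[a_{i,j}]\in M_{n}(R)\mid a_{i,j}=0\text{ if }(i,j)\notin\theta\}$ of $M_n(R)$. *)

theory Defs
  imports "Jordan_Normal_Form.Matrix" "HOL-Algebra.Subrings"
begin

text \<open>
  The library's \<open>ring_mat\<close> is restricted to class \<open>semiring_1\<close>, whose axiom \<open>0 \<noteq> 1\<close> excludes the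
  zero ring. The sort \<open>{ring, monoid_mult}\<close> describes exactly the associative rings with identity,
  the zero ring included; the matrix ring is therefore set up for this sort.
\<close>

definition full_matrix_ring :: "nat \<Rightarrow> 'a::{ring, monoid_mult} mat ring" where
  "full_matrix_ring n =
     \<lparr>carrier = carrier_mat n n, mult = (*), one = 1\<^sub>m n, zero = 0\<^sub>m n n, add = (+)\<rparr>"

text \<open>
  Rows and columns are numbered \<open>1, \<dots>, n\<close> by the relation, whereas \<open>$$\<close> counts from \<open>0\<close>.
\<close>

definition structural_matrix_ring :: "nat \<Rightarrow> (nat \<times> nat) set \<Rightarrow> 'a::{ring, monoid_mult} mat set" where
  "structural_matrix_ring n \<theta> =
     {A \<in> carrier (full_matrix_ring n).
        \<forall>i\<in>{1..n}. \<forall>j\<in>{1..n}. (i, j) \<notin> \<theta> \<longrightarrow> A $$ (i - 1, j - 1) = 0}"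

lemma full_matrix_ring_is_ring:
  "ring (full_matrix_ring n :: 'a::{ring, monoid_mult} mat ring)"
proof (rule ringI)
  show "abelian_group (full_matrix_ring n :: 'a mat ring)"
    by (rule abelian_groupI)
      (auto simp: full_matrix_ring_def assoc_add_mat[of _ n n] comm_add_mat[of _ n n]
        intro!: bexI[of _ "- x" for x])
  show "monoid (full_matrix_ring n :: 'a mat ring)"
    by (rule monoidI)
      (auto simp: full_matrix_ring_def assoc_mult_mat[of _ n n _ n _ n] scalar_prod_def
        if_distrib if_distribR sum.delta cong: if_cong intro!: eq_matI)
qed (auto simp: full_matrix_ring_def add_mult_distrib_mat[of _ n n] mult_add_distrib_mat[of _ n n])

lemma full_matrix_ring_eq_ring_mat:
  "(full_matrix_ring n :: 'a::ring_1 mat ring) = ring_mat TYPE('a) n ()"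
  by (simp add: full_matrix_ring_def ring_mat_def)

lemma structural_matrix_ring_subring:
  assumes "refl_on {1..n} \<theta>" and "trans \<theta>"
  shows "subring (structural_matrix_ring n \<theta>) (full_matrix_ring n :: 'a::{ring, monoid_mult} mat ring)"
proof -
  interpret ring "full_matrix_ring n :: 'a mat ring"
    by (rule full_matrix_ring_is_ring)
  let ?S = "structural_matrix_ring n \<theta> :: 'a mat set"
  show ?thesis
  proof (rule subringI)
    show "?S \<subseteq> carrier (full_matrix_ring n)"
      by (auto simp: structural_matrix_ring_def)
    have "(i, j) \<in> \<theta>" if "i \<in> {1..n}" "j \<in> {1..n}" "i - 1 = j - 1" for i j
      using assms(1) that by (auto simp: refl_on_def dest: eq_diff_iff[THEN iffD1, rotated 2])
    then show "\<one>\<^bsub>full_matrix_ring n\<^esub> \<in> ?S"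
      by (auto simp: structural_matrix_ring_def full_matrix_ring_def)
  next
    fix A :: "'a mat"
    assume A: "A \<in> ?S"
    then have dim: "A \<in> carrier_mat n n" "- A \<in> carrier_mat n n"
      by (auto simp: structural_matrix_ring_def full_matrix_ring_def)
    then have "\<ominus>\<^bsub>full_matrix_ring n\<^esub> A = - A"
      by (intro minus_equality) (auto simp: full_matrix_ring_def)
    with A dim show "\<ominus>\<^bsub>full_matrix_ring n\<^esub> A \<in> ?S"
      by (auto simp: structural_matrix_ring_def full_matrix_ring_def)
  next
    fix A B :: "'a mat"
    assume AB: "A \<in> ?S" "B \<in> ?S"
    then show "A \<oplus>\<^bsub>full_matrix_ring n\<^esub> B \<in> ?S"
      by (auto simp: structural_matrix_ring_def full_matrix_ring_def)
    have dim: "A \<in> carrier_mat n n" "B \<in> carrier_mat n n"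
      using AB by (auto simp: structural_matrix_ring_def full_matrix_ring_def)
    have "(A * B) $$ (i - 1, j - 1) = 0"
      if ij: "i \<in> {1..n}" "j \<in> {1..n}" "(i, j) \<notin> \<theta>" for i j
    proof -
      have "A $$ (i - 1, k) * B $$ (k, j - 1) = 0" if "k < n" for k
      proof -
        have k: "Suc k \<in> {1..n}" using that by simp
        have "(i, Suc k) \<notin> \<theta> \<or> (Suc k, j) \<notin> \<theta>"
          using assms(2) ij(3) by (meson transD)
        then have "A $$ (i - 1, Suc k - 1) = 0 \<or> B $$ (Suc k - 1, j - 1) = 0"
          using AB ij k unfolding structural_matrix_ring_def by blast
        then show ?thesis by auto
      qed
      then show ?thesis
        using ij dim by (auto simp: scalar_prod_def intro!: sum.neutral)
    qed
    with dim show "A \<otimes>\<^bsub>full_matrix_ring n\<^esub> B \<in> ?S"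
      by (auto simp: structural_matrix_ring_def full_matrix_ring_def)
  qed
qed

end

theory Submission
  imports Defs "Jordan_Normal_Form.Determinant"
begin

text \<open>
  Let \<open>B\<close> be the inverse of \<open>A\<close> and suppose \<open>(i, j) \<notin> \<theta>\<close>. By transitivity, the set
  \<open>S = {k. (i, k) \<in> \<theta>}\<close> is such that no row of \<open>A\<close> indexed by \<open>S\<close> has a nonzero entry in a column
  outside \<open>S\<close>; if \<open>E\<close> is the diagonal idempotent supported on \<open>S\<close>, this says \<open>E A = E A E\<close>. So \<open>A\<close> is
  block triangular with respect to \<open>S\<close>. From \<open>A B = 1\<close> one reads off that the diagonal block of \<open>A\<close> at
  \<open>S\<close> has a right inverse. Over a commutative ring a one-sided inverse of a square matrix is
  two-sided (by determinants), so this block can be cancelled, and \<open>B\<close> is block triangular in the same way: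
  \<open>E B = E B E\<close> (\<open>inv_preserves_corner\<close>). As \<open>i \<in> S\<close> by reflexivity while \<open>j \<notin> S\<close>, the
  \<open>(i, j)\<close> entry of \<open>B\<close> vanishes.

  The determinant argument is carried out over rings with \<open>0 \<noteq> 1\<close>, whereas \<open>R\<close> may be the zero ring; as
  \<open>0 \<noteq> 1\<close> belongs to the sort of the ring, a case distinction does not help. The ring \<open>R \<times> \<int>\<close> always
  satisfies \<open>0 \<noteq> 1\<close>; a pair of matrices with \<open>A B = 1\<close> over \<open>R\<close> lifts to such a pair over \<open>R \<times> \<int>\<close>
  by taking the identity matrix as second component, and \<open>B A = 1\<close> is then read off in the first one
  (\<open>right_inverse_imp_left_inverse\<close>).
\<close>

section \<open>The product of a ring with the integers\<close>

datatype 'a times_int = Times_Int (ring_part: 'a) (int_part: int)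

instantiation times_int :: ("{comm_ring, comm_monoid_mult}") comm_ring_1
begin

definition "0 = Times_Int 0 0"
definition "1 = Times_Int 1 1"
definition "x + y = Times_Int (ring_part x + ring_part y) (int_part x + int_part y)"
definition "x - y = Times_Int (ring_part x - ring_part y) (int_part x - int_part y)"
definition "- x = Times_Int (- ring_part x) (- int_part x)"
definition "x * y = Times_Int (ring_part x * ring_part y) (int_part x * int_part y)"

instance
  by standard
    (auto simp: zero_times_int_def one_times_int_def plus_times_int_def minus_times_int_def
      uminus_times_int_def times_times_int_def algebra_simps)

end

lemma ring_part_simps [simp]:
  fixes x y :: "'a::{comm_ring, comm_monoid_mult} times_int"
  shows "ring_part (0 :: 'a times_int) = 0" "ring_part (1 :: 'a times_int) = 1"
    "ring_part (x * y) = ring_part x * ring_part y"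
  by (simp_all add: zero_times_int_def one_times_int_def times_times_int_def)

lemma ring_part_sum:
  fixes f :: "'b \<Rightarrow> 'a::{comm_ring, comm_monoid_mult} times_int"
  shows "ring_part (sum f X) = (\<Sum>k\<in>X. ring_part (f k))"
  by (induction X rule: infinite_finite_induct) (simp_all add: plus_times_int_def)

lemma int_part_sum:
  fixes f :: "'b \<Rightarrow> 'a::{comm_ring, comm_monoid_mult} times_int"
  shows "int_part (sum f X) = (\<Sum>k\<in>X. int_part (f k))"
  by (induction X rule: infinite_finite_induct)
    (simp_all add: plus_times_int_def zero_times_int_def)

section \<open>One-sided inverses of square matrices are two-sided\<close>

text \<open>
  Taking determinants in \<open>A B = 1\<close> shows that \<open>det B\<close> is inverse to \<open>det A\<close>. Multiplying \<open>A B = 1\<close> by the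
  adjugate of \<open>A\<close> gives \<open>det A \<cdot> B = adj A\<close>, so that \<open>B\<close> is the two-sided inverse \<open>det B \<cdot> adj A\<close>.
\<close>

lemma right_inverse_imp_left_inverse_det:
  fixes A B :: "'a::comm_ring_1 mat"
  assumes A: "A \<in> carrier_mat n n" and B: "B \<in> carrier_mat n n" and AB: "A * B = 1\<^sub>m n"
  shows "B * A = 1\<^sub>m n"
proof -
  note adj = adj_mat[OF A]
  have det: "det B * det A = 1"
    using det_mult[OF A B] by (simp add: AB mult.commute)
  have "adj_mat A = adj_mat A * (A * B)"
    using adj(1) by (simp add: AB)
  also have "\<dots> = (adj_mat A * A) * B"
    by (rule assoc_mult_mat[OF adj(1) A B, symmetric])
  also have "\<dots> = det A \<cdot>\<^sub>m B"
    using B by (simp add: adj(3) mult_smult_assoc_mat[of _ n n _ n])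
  finally have "det B \<cdot>\<^sub>m adj_mat A = B"
    using B by (intro eq_matI) (simp_all add: mult.assoc[symmetric] det)
  then have "B * A = (det B \<cdot>\<^sub>m adj_mat A) * A"
    by simp
  also have "\<dots> = det B \<cdot>\<^sub>m (adj_mat A * A)"
    by (rule mult_smult_assoc_mat[OF adj(1) A])
  also have "\<dots> = 1\<^sub>m n"
    using det by (intro eq_matI) (auto simp: adj(3))
  finally show ?thesis .
qed

lemma mat_mult_entry:
  assumes "A \<in> carrier_mat n n" "B \<in> carrier_mat n n" "i < n" "j < n"
  shows "(A * B) $$ (i, j) = (\<Sum>k<n. A $$ (i, k) * B $$ (k, j))"
  using assms by (simp add: scalar_prod_def lessThan_atLeast0)

text \<open>
  The determinant argument applies to the lifts of \<open>A\<close> and \<open>B\<close> to \<open>R \<times> \<int>\<close> whose integer components are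
  identity matrices; lifting in this way is multiplicative and preserves the identity matrix.
\<close>

lemma right_inverse_imp_left_inverse:
  fixes A B :: "'a::{comm_ring, comm_monoid_mult} mat"
  assumes A: "A \<in> carrier_mat n n" and B: "B \<in> carrier_mat n n" and AB: "A * B = 1\<^sub>m n"
  shows "B * A = 1\<^sub>m n"
proof -
  define lift :: "'a mat \<Rightarrow> 'a times_int mat" where
    "lift M = mat n n (\<lambda>(i, j). Times_Int (M $$ (i, j)) (if i = j then 1 else 0))" for M
  have lift: "lift M \<in> carrier_mat n n" for M
    by (simp add: lift_def)
  have lift_entry: "lift M $$ (i, j) = Times_Int (M $$ (i, j)) (if i = j then 1 else 0)"
    if "i < n" "j < n" for M i j
    using that by (simp add: lift_def)
  have lift_mult: "lift M * lift N = lift (M * N)"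
    if M: "M \<in> carrier_mat n n" and N: "N \<in> carrier_mat n n" for M N
  proof (rule eq_matI)
    fix i j
    assume "i < dim_row (lift (M * N))" "j < dim_col (lift (M * N))"
    then have ij: "i < n" "j < n"
      by (simp_all add: lift_def)
    have "ring_part ((lift M * lift N) $$ (i, j)) = ring_part (lift (M * N) $$ (i, j))"
      using ij by (simp add: mat_mult_entry[OF lift lift] mat_mult_entry[OF M N] lift_entry
          ring_part_sum)
    moreover have "int_part ((lift M * lift N) $$ (i, j)) = int_part (lift (M * N) $$ (i, j))"
      using ij by (simp add: mat_mult_entry[OF lift lift] lift_entry int_part_sum
          times_times_int_def if_distrib[of "\<lambda>x. _ * x"] cong: if_cong)
    ultimately show "(lift M * lift N) $$ (i, j) = lift (M * N) $$ (i, j)"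
      by (rule times_int.expand[OF conjI])
  qed (simp_all add: lift_def)
  have lift_one: "lift (1\<^sub>m n) = 1\<^sub>m n"
    by (rule eq_matI) (auto simp: lift_def zero_times_int_def one_times_int_def)
  have "lift A * lift B = 1\<^sub>m n"
    by (simp add: lift_mult[OF A B] AB lift_one)
  then have "lift B * lift A = 1\<^sub>m n"
    by (rule right_inverse_imp_left_inverse_det[OF lift lift])
  then have eq: "lift (B * A) = lift (1\<^sub>m n)"
    by (simp add: lift_mult[OF B A] lift_one)
  have "(B * A) $$ (i, j) = 1\<^sub>m n $$ (i, j)" if "i < n" "j < n" for i j
    using arg_cong[OF eq, of "\<lambda>M. ring_part (M $$ (i, j))"] that by (simp only: lift_entry times_int.sel)
  then show ?thesis
    using A B by (intro eq_matI) auto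
qed

section \<open>Block triangular units\<close>

text \<open>
  For \<open>f = 1 - e\<close>, the elements \<open>x = f + e a\<close> and \<open>y = f + e b\<close> satisfy \<open>x y = 1\<close>, because \<open>e a f = 0\<close>
  and \<open>e a e b = e a b = e\<close>. In a ring where one-sided inverses are two-sided, also \<open>y x = 1\<close>, and
  multiplying this by \<open>f\<close> on the right leaves \<open>f + e b f = f\<close>.
\<close>

lemma (in ring) inv_preserves_corner:
  assumes dedekind_finite: "\<And>x y. \<lbrakk>x \<in> carrier R; y \<in> carrier R; x \<otimes> y = \<one>\<rbrakk> \<Longrightarrow> y \<otimes> x = \<one>"
    and e: "e \<in> carrier R" "e \<otimes> e = e"
    and a: "a \<in> carrier R" and b: "b \<in> carrier R" and ab: "a \<otimes> b = \<one>"
    and corner: "e \<otimes> a = e \<otimes> a \<otimes> e"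
  shows "e \<otimes> b = e \<otimes> b \<otimes> e"
proof -
  define f where "f = \<one> \<ominus> e"
  have f: "f \<in> carrier R"
    using e by (simp add: f_def)
  have sum: "f \<oplus> e = \<one>"
    using e unfolding f_def by algebra
  have ef: "e \<otimes> f = \<zero>" and fe: "f \<otimes> e = \<zero>"
    using e by (simp_all add: f_def minus_eq r_distr l_distr r_minus l_minus r_neg)
  have ff: "f \<otimes> f = f"
    using e(1) f fe r_distr[of f e f] by (simp add: sum)
  have eaf: "e \<otimes> a \<otimes> f = \<zero>"
    by (subst corner) (use e(1) a f in \<open>simp add: m_assoc ef\<close>)
  have eaeb: "e \<otimes> a \<otimes> e \<otimes> b = e"
    using e(1) a b by (simp add: corner[symmetric] m_assoc ab)
  let ?x = "f \<oplus> e \<otimes> a" and ?y = "f \<oplus> e \<otimes> b"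
  have "?x \<otimes> ?y = f \<otimes> f \<oplus> f \<otimes> e \<otimes> b \<oplus> (e \<otimes> a \<otimes> f \<oplus> e \<otimes> a \<otimes> e \<otimes> b)"
    using e(1) f a b by (simp add: l_distr r_distr m_assoc a_ac)
  also have "\<dots> = \<one>"
    using e(1) f b by (simp add: ff fe eaf eaeb sum)
  finally have yx: "?y \<otimes> ?x = \<one>"
    using dedekind_finite e(1) f a b by simp
  have xf: "?x \<otimes> f = f"
    using e(1) f a by (simp add: l_distr ff eaf)
  have "?y \<otimes> f = ?y \<otimes> (?x \<otimes> f)"
    by (simp add: xf)
  also have "\<dots> = f"
    using e(1) f a b by (simp add: m_assoc[symmetric] yx)
  finally have "f \<oplus> e \<otimes> b \<otimes> f = f"
    using e(1) f b by (simp add: l_distr ff)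
  then have "e \<otimes> b \<otimes> f = \<zero>"
    using e(1) f b by simp
  moreover have "e \<otimes> b = e \<otimes> b \<otimes> f \<oplus> e \<otimes> b \<otimes> e"
    using e(1) f b r_distr[of f e "e \<otimes> b"] by (simp add: sum)
  ultimately show ?thesis
    using e(1) b by simp
qed

section \<open>Diagonal idempotents\<close>

text \<open>
  These idempotents express a pattern of zero entries as an equation in the matrix ring, which can be
  transported from \<open>A\<close> to its inverse.
\<close>

definition diag_idem :: "nat \<Rightarrow> nat set \<Rightarrow> 'a::{ring, monoid_mult} mat" where
  "diag_idem n S = mat n n (\<lambda>(i, j). if i = j \<and> i \<in> S then 1 else 0)"

lemma diag_idem_carrier: "diag_idem n S \<in> carrier_mat n n"
  by (simp add: diag_idem_def)

lemma diag_idem_mult_entry: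
  assumes "A \<in> carrier_mat n n" "i < n" "j < n"
  shows "(diag_idem n S * A) $$ (i, j) = (if i \<in> S then A $$ (i, j) else 0)"
    and "(A * diag_idem n S) $$ (i, j) = (if j \<in> S then A $$ (i, j) else 0)"
proof -
  have "(diag_idem n S * A) $$ (i, j) = (\<Sum>k<n. if k = i then if i \<in> S then A $$ (i, j) else 0 else 0)"
    unfolding mat_mult_entry[OF diag_idem_carrier assms]
    using assms by (intro sum.cong) (auto simp: diag_idem_def)
  then show "(diag_idem n S * A) $$ (i, j) = (if i \<in> S then A $$ (i, j) else 0)"
    using assms by simp
  have "(A * diag_idem n S) $$ (i, j) = (\<Sum>k<n. if k = j then if j \<in> S then A $$ (i, j) else 0 else 0)"
    unfolding mat_mult_entry[OF assms(1) diag_idem_carrier assms(2,3)]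
    using assms by (intro sum.cong) (auto simp: diag_idem_def)
  then show "(A * diag_idem n S) $$ (i, j) = (if j \<in> S then A $$ (i, j) else 0)"
    using assms by simp
qed

lemma diag_idem_idem: "diag_idem n S * diag_idem n S = diag_idem n S"
proof (rule eq_matI)
  fix i j
  assume "i < dim_row (diag_idem n S)" "j < dim_col (diag_idem n S)"
  then have ij: "i < n" "j < n"
    by (simp_all add: diag_idem_def)
  then show "(diag_idem n S * diag_idem n S) $$ (i, j) = diag_idem n S $$ (i, j)"
    by (subst diag_idem_mult_entry(1)[OF diag_idem_carrier ij]) (simp add: diag_idem_def)
qed (simp_all add: diag_idem_def)

lemma diag_idem_corner_iff:
  assumes A: "A \<in> carrier_mat n n"
  shows "diag_idem n S * A = diag_idem n S * A * diag_idem n S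
    \<longleftrightarrow> (\<forall>i<n. \<forall>j<n. i \<in> S \<longrightarrow> j \<notin> S \<longrightarrow> A $$ (i, j) = 0)"
proof -
  let ?E = "diag_idem n S"
  have EA: "?E * A \<in> carrier_mat n n"
    using A diag_idem_carrier by (rule mult_carrier_mat[rotated])
  have "?E * A = ?E * A * ?E \<longleftrightarrow> (\<forall>i<n. \<forall>j<n. (?E * A) $$ (i, j) = (?E * A * ?E) $$ (i, j))"
    using A by (auto simp: mat_eq_iff diag_idem_def)
  also have "\<dots> \<longleftrightarrow> (\<forall>i<n. \<forall>j<n. i \<in> S \<longrightarrow> j \<notin> S \<longrightarrow> A $$ (i, j) = 0)"
    by (auto simp: diag_idem_mult_entry(1)[OF A] diag_idem_mult_entry(2)[OF EA])
  finally show ?thesis .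
qed

section \<open>Inverses in structural matrix rings\<close>

theorem theorem3p3:
  fixes n :: nat and \<theta> :: "(nat \<times> nat) set" and A :: "'a::{comm_ring, comm_monoid_mult} mat"
  assumes "n \<ge> 1"
    and "\<theta> \<subseteq> {1..n} \<times> {1..n}" and "refl_on {1..n} \<theta>" and "trans \<theta>"
    and "A \<in> structural_matrix_ring n \<theta>"
    and "A \<in> Units (full_matrix_ring n)"
  shows "inv\<^bsub>full_matrix_ring n\<^esub> A \<in> structural_matrix_ring n \<theta>"
proof -
  let ?R = "full_matrix_ring n :: 'a mat ring"
  interpret ring ?R
    by (rule full_matrix_ring_is_ring)
  define B where "B = inv\<^bsub>?R\<^esub> A"
  have B: "B \<in> carrier ?R" and AB: "A \<otimes>\<^bsub>?R\<^esub> B = \<one>\<^bsub>?R\<^esub>" and A: "A \<in> carrier ?R"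
    using assms(6) by (simp_all add: B_def Units_closed)
  have carrier: "carrier ?R = carrier_mat n n"
    by (simp add: full_matrix_ring_def)
  have mult: "X \<otimes>\<^bsub>?R\<^esub> Y = X * Y" for X Y
    by (simp add: full_matrix_ring_def)
  have one: "\<one>\<^bsub>?R\<^esub> = 1\<^sub>m n"
    by (simp add: full_matrix_ring_def)
  have "B $$ (i - 1, j - 1) = 0" if ij: "i \<in> {1..n}" "j \<in> {1..n}" "(i, j) \<notin> \<theta>" for i j
  proof -
    define S where "S = {k. (i, Suc k) \<in> \<theta>}"
    let ?E = "diag_idem n S :: 'a mat"
    have "A $$ (k, l) = 0" if kl: "k < n" "l < n" "k \<in> S" "l \<notin> S" for k l
    proof -
      have "(Suc k, Suc l) \<notin> \<theta>"
        using kl(3,4) assms(4) by (auto simp: S_def dest: transD)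
      moreover have "Suc k \<in> {1..n}" "Suc l \<in> {1..n}"
        using kl(1,2) by simp_all
      ultimately have "A $$ (Suc k - 1, Suc l - 1) = 0"
        using assms(5) unfolding structural_matrix_ring_def by blast
      then show ?thesis
        by simp
    qed
    then have corner: "?E * A = ?E * A * ?E"
      using A by (simp only: diag_idem_corner_iff carrier) blast
    have "?E * B = ?E * B * ?E"
    proof (rule inv_preserves_corner[of ?E A B, unfolded mult])
      show "Y * X = \<one>\<^bsub>?R\<^esub>"
        if "X \<in> carrier ?R" "Y \<in> carrier ?R" "X * Y = \<one>\<^bsub>?R\<^esub>" for X Y
        using that right_inverse_imp_left_inverse[of X n Y] by (simp only: carrier one)
      show "?E \<in> carrier ?R"
        by (simp only: carrier diag_idem_carrier)
    qed (fact diag_idem_idem A B AB[unfolded mult] corner)+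
    then have "B $$ (k, l) = 0" if "k < n" "l < n" "k \<in> S" "l \<notin> S" for k l
      using B that by (simp only: diag_idem_corner_iff carrier) blast
    moreover have "i - 1 \<in> S" "j - 1 \<notin> S" "i - 1 < n" "j - 1 < n"
      using ij assms(3) by (auto simp: S_def refl_on_def)
    ultimately show ?thesis
      by blast
  qed
  then have "B \<in> structural_matrix_ring n \<theta>"
    using B by (simp add: structural_matrix_ring_def)
  then show ?thesis
    by (simp only: B_def)
qed

end
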